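(* Let $q$ be a power of an odd prime $p$, and let $C_k=\frac{1}{k+1}\binom{2k}{k}$ denote the $k$th Catalan number. Then in $\mathbb{Z}[x]$, \[ \sum_{k=0}^{q-1}C_kx^{k+1}\equiv\frac{1-(1-4x)^{(q+1)/2}}{2}-x^q\pmod{p}. \] *)

theory Defs
  imports "HOL-Computational_Algebra.Computational_Algebra"
begin

text \<open>The division is exact, see \<open>of_nat_catalan\<close> below.\<close>

definition catalan :: "nat \<Rightarrow> nat" where
  "catalan k = ((2 * k) choose k) div (k + 1)"

lemma Suc_dvd_central_binomial: "k + 1 dvd ((2 * k) choose k)"
proof -
  have "Suc k * ((2 * k) choose Suc k) = k * ((2 * k) choose k)"
    using binomial_absorption[of k "2 * k"] binomial_absorb_comp[of "2 * k" k]
    by (metis add_diff_cancel_right' mult_2)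
  then have "Suc k dvd k * ((2 * k) choose k)"
    by (metis dvd_triv_left)
  then show ?thesis
    by (simp add: coprime_dvd_mult_right_iff)
qed

lemma of_nat_catalan:
  "(of_nat (catalan k) :: 'a :: field_char_0) = 1 / of_nat (k + 1) * of_nat ((2 * k) choose k)"
proof -
  have "((2 * k) choose k) = (k + 1) * catalan k"
    unfolding catalan_def by (rule dvd_mult_div_cancel[OF Suc_dvd_central_binomial, symmetric])
  then have "(of_nat ((2 * k) choose k) :: 'a) = of_nat (k + 1) * of_nat (catalan k)"
    by (simp only: of_nat_mult)
  moreover have "(of_nat (k + 1) :: 'a) \<noteq> 0"
    by (simp only: of_nat_eq_0_iff)
  ultimately show ?thesis
    by (simp only: times_divide_eq_left mult_1 nonzero_mult_div_cancel_left not_False_eq_True)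
qed

text \<open>
  Congruence of integer polynomials modulo an integer, i.e. modulo the ideal generated by it
  in the ring of integer polynomials. (The library's \<open>cong\<close> is defined through \<open>mod\<close>, which
  integer polynomials do not have.)
\<close>

definition int_poly_cong :: "int poly \<Rightarrow> int poly \<Rightarrow> int \<Rightarrow> bool" where
  "int_poly_cong f g m \<longleftrightarrow> [:m:] dvd f - g"

lemma int_poly_cong_iff_coeff:
  "int_poly_cong f g m \<longleftrightarrow> (\<forall>i. m dvd coeff f i - coeff g i)"
  by (simp add: int_poly_cong_def const_poly_dvd_iff)

text \<open>
  Halving \<open>1 - (1 - 4x)^m\<close> by \<open>div\<close> on integer polynomials is exact.
\<close>

lemma two_times_half_one_minus_power:
  "2 * ((1 - [:1, -4:] ^ m) div 2) = (1 - [:1, -4:] ^ m :: int poly)"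
proof -
  have "(2 :: int poly) dvd 1 - [:1, -4:]"
    by (rule dvdI[of _ _ "[:0, 2:]"]) (simp add: numeral_poly one_pCons)
  moreover have "1 - [:1, -4:] dvd (1 - [:1, -4:] ^ m :: int poly)"
    using one_diff_power_eq'[of "[:1, -4:] :: int poly" m] by simp
  ultimately show ?thesis
    by (meson dvd_mult_div_cancel dvd_trans)
qed

end

theory Submission
  imports Defs
begin

text \<open>
  The power series \<open>c = \<Sum>k. C\<^sub>k X ^ (k + 1)\<close> satisfies \<open>(1 - 2c)\<^sup>2 = 1 - 4X\<close>, so that
  \<open>(1 - 4X) ^ ((q + 1) / 2) = (1 - 2c) (1 - 2c) ^ q\<close>. Modulo \<open>p\<close>, the last factor is
  \<open>1 - 2c ^ q\<close>, and \<open>c ^ q\<close> agrees with \<open>X ^ q\<close> up to degree \<open>q\<close>. Comparing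
  coefficients up to degree \<open>q\<close> and cancelling a factor \<open>2\<close> gives the congruence; in
  higher degrees both sides vanish.
\<close>

text \<open>The inner binomial coefficients are multiples of \<open>p\<close>. Divisibility by
  \<open>of_nat p\<close> lets the Frobenius identity be used in \<open>int fps\<close>, without
  passing to a quotient ring.\<close>

lemma prime_dvd_add_power_diff:
  fixes a b :: "'a :: comm_ring_1"
  assumes "prime p"
  shows "of_nat p dvd (a + b) ^ p - (a ^ p + b ^ p)"
proof -
  have p: "p > 0" using assms by (rule prime_gt_0_nat)
  let ?f = "\<lambda>k. of_nat (p choose k) * a ^ k * b ^ (p - k)"
  have "{..p} = insert 0 (insert p {0<..<p})"
    using p by auto
  then have "(a + b) ^ p - (a ^ p + b ^ p) = (\<Sum>k\<in>{0<..<p}. ?f k)"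
    using p by (simp add: binomial_ring)
  also have "of_nat p dvd \<dots>"
  proof (rule dvd_sum)
    fix k assume "k \<in> {0<..<p}"
    then have "p dvd p choose k"
      using assms by (intro dvd_choose_prime) auto
    then show "(of_nat p :: 'a) dvd ?f k"
      by (auto elim!: dvdE simp: mult.assoc)
  qed
  finally show ?thesis .
qed

text \<open>Induction on \<open>n\<close>: since \<open>x - y\<close> divides
  \<open>x ^ p - y ^ p\<close>, the congruence for \<open>p ^ n\<close> survives raising both sides
  to the power \<open>p\<close>; the prime case then splits the sum.\<close>

lemma prime_dvd_add_prime_power_diff:
  fixes a b :: "'a :: comm_ring_1"
  assumes "prime p"
  shows "of_nat p dvd (a + b) ^ (p ^ n) - (a ^ (p ^ n) + b ^ (p ^ n))"
proof (induction n)
  case 0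
  show ?case by simp
next
  case (Suc n)
  let ?x = "(a + b) ^ (p ^ n)" and ?y = "a ^ (p ^ n)" and ?z = "b ^ (p ^ n)"
  have "?x - (?y + ?z) dvd ?x ^ p - (?y + ?z) ^ p"
    by (simp add: power_diff_sumr2)
  with Suc.IH have "of_nat p dvd ?x ^ p - (?y + ?z) ^ p"
    by (rule dvd_trans)
  then have "of_nat p dvd (?x ^ p - (?y + ?z) ^ p) + ((?y + ?z) ^ p - (?y ^ p + ?z ^ p))"
    using prime_dvd_add_power_diff[OF assms] by (rule dvd_add)
  also have "\<dots> = ?x ^ p - (?y ^ p + ?z ^ p)"
    by simp
  finally show ?case
    by (simp add: mult.commute[of p] flip: power_mult)
qed

lemma Suc_times_catalan: "Suc k * catalan k = (2 * k) choose k"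
  unfolding catalan_def using dvd_mult_div_cancel[OF Suc_dvd_central_binomial[of k]] by simp

lemma catalan_0 [simp]: "catalan 0 = 1"
  by (simp add: catalan_def)

text \<open>Two absorption identities relate consecutive central binomial coefficients; the extra
  factor \<open>Suc k\<close> is cancelled at the end.\<close>

lemma catalan_Suc: "(k + 2) * catalan (Suc k) = 2 * (2 * k + 1) * catalan k"
proof -
  have 1: "Suc k * (Suc (Suc (2 * k)) choose Suc k) = 2 * (Suc k) * (Suc (2 * k) choose k)"
    using Suc_times_binomial_eq[of "Suc (2 * k)" k] by simp
  have 2: "Suc k * (Suc (2 * k) choose k) = Suc (2 * k) * ((2 * k) choose k)"
    using binomial_absorb_comp[of "Suc (2 * k)" k] by simp
  have "Suc k * ((k + 2) * catalan (Suc k)) = Suc k * (Suc (Suc (2 * k)) choose Suc k)"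
    using Suc_times_catalan[of "Suc k"] by simp
  also have "\<dots> = 2 * (Suc (2 * k) * (Suc k * catalan k))"
    unfolding 1 mult.assoc 2 Suc_times_catalan ..
  also have "\<dots> = Suc k * (2 * (2 * k + 1) * catalan k)"
    by (simp add: algebra_simps)
  finally have "Suc k * ((k + 2) * catalan (Suc k)) = Suc k * (2 * (2 * k + 1) * catalan k)" .
  then show ?thesis
    by (simp only: mult_cancel1) simp
qed

definition catalan_fps :: "int fps" where
  "catalan_fps = Abs_fps (\<lambda>n. int (catalan n))"

definition sqrt_fps :: "int fps" where
  "sqrt_fps = 1 - 2 * fps_X * catalan_fps"

lemma sqrt_fps_nth_0 [simp]: "sqrt_fps $ 0 = 1"
  by (simp add: sqrt_fps_def)

lemma sqrt_fps_nth_Suc [simp]: "sqrt_fps $ Suc k = - 2 * int (catalan k)"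
  by (simp add: sqrt_fps_def catalan_fps_def mult.assoc numeral_fps_const)

text \<open>The differential equation of the square root of \<open>1 - 4X\<close>; read
  coefficientwise it is the recurrence \<open>catalan_Suc\<close>.\<close>

lemma sqrt_fps_deriv: "(1 - 4 * fps_X) * fps_deriv sqrt_fps = - 2 * sqrt_fps"
proof (rule fps_ext)
  fix k
  show "((1 - 4 * fps_X) * fps_deriv sqrt_fps) $ k = (- 2 * sqrt_fps) $ k"
  proof (cases k)
    case 0
    then show ?thesis by (simp add: neg_numeral_fps_const)
  next
    case (Suc j)
    have "(int j + 2) * int (catalan (Suc j)) = 2 * (2 * int j + 1) * int (catalan j)"
      using arg_cong[OF catalan_Suc[of j], of int] by (simp add: algebra_simps)
    then show ?thesis
      by (simp add: Suc left_diff_distrib mult.assoc numeral_fps_const) (simp add: algebra_simps)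
  qed
qed

text \<open>No Catalan convolution is needed: the square inherits a first-order differential
  equation, which together with its constant term determines it.\<close>

lemma sqrt_fps_squared: "sqrt_fps ^ 2 = 1 - 4 * fps_X"
proof -
  define u where "u = sqrt_fps ^ 2"
  have "(1 - 4 * fps_X) * fps_deriv u = 2 * sqrt_fps * ((1 - 4 * fps_X) * fps_deriv sqrt_fps)"
    by (simp add: u_def power2_eq_square algebra_simps)
  then have deriv: "(1 - 4 * fps_X) * fps_deriv u = - 4 * u"
    unfolding sqrt_fps_deriv by (simp add: u_def power2_eq_square algebra_simps)
  have u0: "u $ 0 = 1"
    by (simp add: u_def power2_eq_square)
  have rec: "(int k + 1) * u $ Suc k = 4 * (int k - 1) * u $ k" for k
    using arg_cong[OF deriv, of "\<lambda>f. f $ k"]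
    by (cases k) (simp_all add: left_diff_distrib mult.assoc numeral_fps_const algebra_simps)
  \<comment> \<open>At \<open>k = 1\<close> the factor \<open>int k - 1\<close> in
    \<open>rec\<close> is zero, which kills the coefficient of degree 2 and, through
    \<open>rec\<close>, all later ones.\<close>
  have "u $ Suc (Suc k) = 0" for k
  proof (induction k)
    case 0
    show ?case using rec[of 1] by simp
  next
    case (Suc k)
    show ?case using rec[of "Suc (Suc k)"] Suc.IH by simp
  qed
  moreover have "u $ Suc 0 = - 4"
    using rec[of 0] u0 by simp
  ultimately have "u $ k = (1 - 4 * fps_X) $ k" for k
    using u0 by (cases k; cases "k - 1") (simp_all add: numeral_fps_const)
  then show ?thesis
    by (simp add: u_def fps_eq_iff)
qed

lemma of_nat_dvd_fps_nth:
  fixes f :: "int fps"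
  assumes "of_nat m dvd f"
  shows "int m dvd f $ i"
  using assms by (elim dvdE) (simp flip: fps_of_nat)

lemma sqrt_fps_prime_power:
  assumes "prime p" and "odd p"
  shows "of_nat p dvd sqrt_fps ^ (p ^ n) - (1 - 2 * fps_X ^ (p ^ n) * catalan_fps ^ (p ^ n))"
proof -
  let ?q = "p ^ n" and ?c = "(fps_X * catalan_fps) ^ (p ^ n)"
  have "odd ?q" using assms by simp
  have "of_nat p dvd (1 + (- 2) * (fps_X * catalan_fps)) ^ ?q - (1 ^ ?q + ((- 2) * (fps_X * catalan_fps)) ^ ?q)"
    by (rule prime_dvd_add_prime_power_diff[OF assms(1)])
  then have 1: "of_nat p dvd sqrt_fps ^ ?q - (1 + (- 2) ^ ?q * ?c)"
    by (simp only: power_mult_distrib power_one) (simp add: sqrt_fps_def mult.assoc power_mult_distrib)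
  \<comment> \<open>Writing \<open>- 2\<close> as \<open>- 1 + - 1\<close> gives Fermat's congruence
    for \<open>- 2\<close> from the same lemma, as \<open>?q\<close> is odd.\<close>
  have "of_nat p dvd (- 1 + - 1) ^ ?q - ((- 1) ^ ?q + (- 1) ^ ?q :: int fps)"
    by (rule prime_dvd_add_prime_power_diff[OF assms(1)])
  then have "of_nat p dvd (- 2) ^ ?q - (- 2 :: int fps)"
    using \<open>odd ?q\<close> by simp
  then have "of_nat p dvd ((- 2) ^ ?q - (- 2)) * ?c"
    by (rule dvd_mult2)
  with 1 have "of_nat p dvd (sqrt_fps ^ ?q - (1 + (- 2) ^ ?q * ?c)) + ((- 2) ^ ?q - (- 2)) * ?c"
    by (rule dvd_add)
  also have "\<dots> = sqrt_fps ^ ?q - (1 - 2 * ?c)"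
    by (simp add: algebra_simps)
  finally show ?thesis
    by (simp add: power_mult_distrib mult.assoc)
qed

text \<open>The correction \<open>fps_X ^ q * (2 * catalan_fps ^ q * sqrt_fps)\<close> starts in
  degree \<open>q\<close>, and its coefficient there is 2 because both series have constant term
  1.\<close>

lemma coeff_power_one_minus_4X_cong:
  assumes "prime p" and "odd p" and "q = p ^ n" and "i \<le> q"
  shows "int p dvd coeff ([:1, -4:] ^ ((q + 1) div 2)) i
           - (sqrt_fps $ i - (if i = q then 2 else 0))"
proof -
  have "odd q" using assms by simp
  then have "2 * ((q + 1) div 2) = Suc q"
    by simp
  have "fps_of_poly [:1, -4:] = sqrt_fps ^ 2"
    by (simp add: sqrt_fps_squared fps_of_poly_pCons fps_numeral_fps_const)
  then have "fps_of_poly ([:1, -4:] ^ ((q + 1) div 2)) = sqrt_fps ^ Suc q"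
    by (simp only: fps_of_poly_power flip: power_mult) (simp only: \<open>2 * ((q + 1) div 2) = Suc q\<close>)
  then have "fps_of_poly ([:1, -4:] ^ ((q + 1) div 2))
      - (sqrt_fps - fps_X ^ q * (2 * catalan_fps ^ q * sqrt_fps))
    = (sqrt_fps ^ q - (1 - 2 * fps_X ^ q * catalan_fps ^ q)) * sqrt_fps"
    by (simp add: algebra_simps)
  also have "of_nat p dvd \<dots>"
    using sqrt_fps_prime_power[OF assms(1,2), of n] unfolding assms(3) by (rule dvd_mult2)
  finally have "int p dvd (fps_of_poly ([:1, -4:] ^ ((q + 1) div 2))
      - (sqrt_fps - fps_X ^ q * (2 * catalan_fps ^ q * sqrt_fps))) $ i"
    by (rule of_nat_dvd_fps_nth)
  moreover have "catalan_fps $ 0 = 1"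
    by (simp add: catalan_fps_def)
  ultimately show ?thesis
    using \<open>i \<le> q\<close> by (simp add: fps_X_power_mult_nth mult.assoc numeral_fps_const fps_power_zeroth
      split: if_splits)
qed

theorem theorem2p3:
  fixes p q n :: nat
  assumes "prime p" and "odd p" and "n \<ge> 1" and "q = p ^ n"
  shows "int_poly_cong
           (\<Sum>k=0..q-1. monom (int (catalan k)) (k + 1))
           ((1 - [:1, -4:] ^ ((q + 1) div 2)) div 2 - monom 1 q)
           (int p)"
  unfolding int_poly_cong_iff_coeff
proof
  fix i
  let ?F = "\<Sum>k=0..q-1. monom (int (catalan k)) (k + 1)"
  let ?P = "[:1, -4:] ^ ((q + 1) div 2) :: int poly"
  let ?D = "coeff ?F i - coeff ((1 - ?P) div 2 - monom 1 q) i"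
  have "q > 0"
    using assms by (simp add: prime_gt_0_nat)
  have half: "2 * coeff ((1 - ?P) div 2) i = coeff (1 - ?P) i"
    using arg_cong[OF two_times_half_one_minus_power, of "\<lambda>f. coeff f i"]
    by (simp only: numeral_poly coeff_smult mult_smult_left) simp
  have F: "coeff ?F i = (if i \<in> {1..q} then int (catalan (i - 1)) else 0)"
  proof (cases i)
    case (Suc j)
    then show ?thesis
      using \<open>q > 0\<close> by (auto simp: coeff_sum)
  qed (simp add: coeff_sum)
  show "int p dvd ?D"
  proof (cases "i \<le> q")
    case True
    have "2 * coeff ?F i = coeff 1 i - sqrt_fps $ i"
      using True unfolding F by (cases i) auto
    \<comment> \<open>The 2 at \<open>i = q\<close> is the doubled coefficient of
      \<open>monom 1 q\<close>.\<close>
    then have "2 * ?D = coeff ?P i - (sqrt_fps $ i - (if i = q then 2 else 0))"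
      using half \<open>q > 0\<close> by (auto simp: algebra_simps)
    then have "int p dvd 2 * ?D"
      using coeff_power_one_minus_4X_cong[OF assms(1,2,4) True] by simp
    moreover have "coprime (int p) 2"
      using \<open>odd p\<close> by simp
    ultimately show ?thesis
      by (simp only: coprime_dvd_mult_right_iff)
  next
    case False
    \<comment> \<open>The bound is \<open>(q + 1) div 2\<close>, which is at most \<open>q\<close>
      since \<open>q > 0\<close>.\<close>
    have "degree ?P \<le> degree [:1, - 4 :: int:] * ((q + 1) div 2)"
      by (rule degree_power_le)
    then have "degree ?P < i"
      using False \<open>q > 0\<close> by simp
    then have "coeff (1 - ?P) i = 0"
      using False by (simp add: coeff_eq_0)
    then show ?thesis
      using half F False by simp
  qed
qed

end
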